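(* Let $f_i:\mathbb{R}^p\to\mathbb{R}$ ($i=1,\dots,n$) be differentiable with $L_{f_i}$-Lipschitz gradients ($L_{f_i}>0$), let $L_f=\max_iL_{f_i}$, and let $W$ be a mixing matrix (see context). Let $0<\epsilon\le1$ and $\alpha_k=\frac{1}{L_f(k+1)^\epsilon}$, let ${\bf x}^0\in\mathbb{R}^{n\times p}$ be arbitrary, and let $\{{\bf x}^k\}$ be the DGD sequence $${\bf x}^{k+1}=W{\bf x}^k-\alpha_k\nabla{\bf f}({\bf x}^k),\qquad k=0,1,\dots$$ Suppose there is a constant $B>0$ with $\|\nabla{\bf f}({\bf x}^k)\|\le B$ for all $k$. Let $\bar{\bf x}^k=\frac1n{\bf 1}{\bf 1}^T{\bf x}^k$. Then $\|{\bf x}^k-\bar{\bf x}^k\|$ converges to $0$ at the rate $\mathcal{O}(1/(k+1)^\epsilon)$.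
   Context: Notation. $\mathcal{G}=(\mathcal{V},\mathcal{E})$ is a connected undirected graph with $\mathcal{V}=\{1,\dots,n\}$. For ${\bf x}\in\mathbb{R}^{n\times p}$, ${\bf x}_{(i)}\in\mathbb{R}^p$ is its $i$-th row (as a column vector), $\|\cdot\|$ is the Frobenius norm, $I$ the $n\times n$ identity, ${\bf 1}\in\mathbb{R}^n$ the all-ones vector, and $\nabla{\bf f}({\bf x})\in\mathbb{R}^{n\times p}$ is the matrix whose $i$-th row is $\nabla f_i({\bf x}_{(i)})^T$. Mixing matrix: $W=[w_{ij}]\in\mathbb{R}^{n\times n}$ such that (1) $w_{ij}=0$ if $i\ne j$ and $(i,j)\notin\mathcal{E}$, and $w_{ij}>0$ otherwise; (2) $W=W^T$; (3) $\mathrm{null}(I-W)=\mathrm{span}\{{\bf 1}\}$; (4) $I\succeq W\succ -I$. *)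

theory Defs
  imports "HOL-Analysis.Analysis" "HOL-Library.Landau_Symbols"
begin

text \<open>
  The vertex set is the finite type \<open>'n\<close> (so \<open>n = CARD('n)\<close>), and an \<open>n \<times> p\<close> matrix \<open>x\<close> has type
  \<open>real ^ 'p ^ 'n\<close>: its \<open>i\<close>-th row is \<open>x $ i\<close>, and its \<open>norm\<close>, the Euclidean norm of the vector of
  Euclidean norms of the rows, is the Frobenius norm.
\<close>

definition connected_undirected_graph :: "('n \<times> 'n) set \<Rightarrow> bool" where
  "connected_undirected_graph E \<longleftrightarrow> sym E \<and> (\<forall>i j. (i, j) \<in> E\<^sup>*)"

definition pos_semidef :: "real ^ 'n ^ 'n \<Rightarrow> bool" where
  "pos_semidef A \<longleftrightarrow> transpose A = A \<and> (\<forall>v. 0 \<le> v \<bullet> (A *v v))"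

definition pos_def :: "real ^ 'n ^ 'n \<Rightarrow> bool" where
  "pos_def A \<longleftrightarrow> transpose A = A \<and> (\<forall>v. v \<noteq> 0 \<longrightarrow> 0 < v \<bullet> (A *v v))"

definition ones :: "real ^ 'n" where
  "ones = (\<chi> i. 1)"

text \<open>
  The last two conjuncts say \<open>I \<succeq> W\<close> and \<open>W \<succ> -I\<close> in the Loewner order.
\<close>

definition mixing_matrix :: "('n \<times> 'n) set \<Rightarrow> real ^ 'n ^ 'n \<Rightarrow> bool" where
  "mixing_matrix E W \<longleftrightarrow>
     (\<forall>i j. if i \<noteq> j \<and> (i, j) \<notin> E then W $ i $ j = 0 else W $ i $ j > 0) \<and>
     W = transpose W \<and>
     {v. (mat 1 - W) *v v = 0} = span {ones} \<and>
     pos_semidef (mat 1 - W) \<and>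
     pos_def (W - (- mat 1))"

text \<open>
  The gradient is unique where it exists; the value is unspecified at points where \<open>g\<close> is not
  differentiable.
\<close>

definition gradient :: "('a::real_inner \<Rightarrow> real) \<Rightarrow> 'a \<Rightarrow> 'a" where
  "gradient g z = (THE D. GDERIV g z :> D)"

definition stacked_gradient :: "('n \<Rightarrow> real ^ 'p \<Rightarrow> real) \<Rightarrow> real ^ 'p ^ 'n \<Rightarrow> real ^ 'p ^ 'n" where
  "stacked_gradient f x = (\<chi> i. gradient (f i) (x $ i))"

definition row_average :: "real ^ 'p ^ 'n \<Rightarrow> real ^ 'p ^ 'n" where
  "row_average x = (1 / real CARD('n)) *\<^sub>R 
     (((columnvector ones :: real ^ 1 ^ 'n) ** (rowvector ones :: real ^ 'n ^ 1)) ** x)"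

definition dgd_sequence ::
  "real ^ 'n ^ 'n \<Rightarrow> (nat \<Rightarrow> real) \<Rightarrow> ('n \<Rightarrow> real ^ 'p \<Rightarrow> real) \<Rightarrow> (nat \<Rightarrow> real ^ 'p ^ 'n) \<Rightarrow> bool" where
  "dgd_sequence W \<alpha> f x \<longleftrightarrow> (\<forall>k. x (Suc k) = W ** x k - \<alpha> k *\<^sub>R stacked_gradient f (x k))"

end

theory Submission
  imports Defs "HOL-Real_Asymp.Real_Asymp"
begin

text \<open>
  Let \<open>P x = x - row_average x\<close> be the disagreement of the rows of \<open>x\<close>. Since \<open>W\<close> is symmetric
  and fixes the all-ones vector, it commutes with averaging, so one step of the iteration gives
  \<open>P (x (Suc k)) = W ** P (x k) - \<alpha> k *\<^sub>R P (g k)\<close> with \<open>g k\<close> the stacked gradient.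

  The columns of \<open>P x\<close> are orthogonal to the all-ones vector, and on that hyperplane \<open>W\<close> is a
  contraction with some factor \<open>\<rho> < 1\<close> (\<open>mixing_matrix_contraction\<close>): the Loewner bounds
  \<open>-I \<prec> W \<preceq> I\<close> together with the null space condition exclude every eigenvalue of modulus
  at least \<open>1\<close> there. No spectral theorem enters: an algebraic identity shows that \<open>W\<close> strictly
  decreases the norm of each vector that it does not fix
  (\<open>norm_less_of_spectrum_in_half_open_interval\<close>), and compactness of the unit sphere of the
  hyperplane turns this into one uniform factor (\<open>uniform_contraction_on_subspace\<close>).

  As the gradients are bounded, the disagreement \<open>a k = norm (P (x k))\<close> satisfies
  \<open>a (Suc k) \<le> \<rho> * a k + c * b k\<close> with \<open>b k = 1 / (real k + 1) powr \<epsilon>\<close>. Memory of earlier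
  errors is lost geometrically, whereas \<open>b\<close> decays only polynomially (the ratio of successive terms
  tends to \<open>1\<close>), so the most recent perturbations dominate and \<open>a \<in> O(b)\<close>
  (\<open>bigo_of_contracting_recursion\<close>).
\<close>

section \<open>Contraction by self-adjoint operators\<close>

text \<open>
  Put \<open>A = I - T\<close> and \<open>B = I + T\<close>, which commute and add up to \<open>2I\<close>. Then
  \<open>2 (I - T\<^sup>2) = AB(A + B) = ABA + BAB\<close>, so the loss of squared norm under \<open>T\<close> is half the
  sum of the quadratic forms of \<open>B\<close> at \<open>A v\<close> and of \<open>A\<close> at \<open>B v\<close>. The first is positive
  as soon as \<open>A v \<noteq> 0\<close>.
\<close>

lemma norm_less_of_spectrum_in_half_open_interval:
  fixes T :: "'a::real_inner \<Rightarrow> 'a"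
  assumes lin: "linear T"
    and self_adjoint: "\<And>u v. T u \<bullet> v = u \<bullet> T v"
    and upper: "\<And>v. 0 \<le> v \<bullet> (v - T v)"
    and lower: "\<And>v. v \<noteq> 0 \<Longrightarrow> 0 < v \<bullet> (v + T v)"
    and not_fixed: "T v \<noteq> v"
  shows "norm (T v) < norm v"
proof -
  define a b where "a = v - T v" and "b = v + T v"
  have "0 < a \<bullet> (a + T a)"
    using lower[of a] not_fixed by (simp add: a_def)
  moreover have "0 \<le> b \<bullet> (b - T b)"
    by (rule upper)
  moreover have "a \<bullet> (a + T a) + b \<bullet> (b - T b) = 2 * (v \<bullet> v - T v \<bullet> T v)"
  proof -
    have "a + T a = v - T (T v)" "b - T b = v - T (T v)" "a + b = 2 *\<^sub>R v"
      by (simp_all add: a_def b_def linear_add[OF lin] linear_diff[OF lin] scaleR_2)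
    then have "a \<bullet> (a + T a) + b \<bullet> (b - T b) = (2 *\<^sub>R v) \<bullet> (v - T (T v))"
      by (simp flip: inner_add_left)
    then show ?thesis
      by (simp add: inner_diff_right self_adjoint)
  qed
  ultimately have "(norm (T v))\<^sup>2 < (norm v)\<^sup>2"
    by (simp add: power2_norm_eq_inner)
  then show ?thesis
    by (rule power2_less_imp_less) simp
qed

text \<open>
  The factor is the maximum of \<open>norm (T v)\<close> over the unit sphere of \<open>S\<close>, which is attained because
  that sphere is compact.
\<close>

lemma uniform_contraction_on_subspace:
  fixes T :: "'a::euclidean_space \<Rightarrow> 'a"
  assumes lin: "linear T" and sub: "subspace S"
    and strict: "\<And>v. v \<in> S \<Longrightarrow> v \<noteq> 0 \<Longrightarrow> norm (T v) < norm v"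
  obtains \<rho> where "0 \<le> \<rho>" "\<rho> < 1" "\<And>v. v \<in> S \<Longrightarrow> norm (T v) \<le> \<rho> * norm v"
proof (cases "S \<inter> sphere 0 1 = {}")
  case True
  \<comment> \<open>An empty unit sphere means that \<open>S\<close> is trivial, so any factor serves.\<close>
  have "v = 0" if "v \<in> S" for v
  proof (rule ccontr)
    assume "v \<noteq> 0"
    then have "(1 / norm v) *\<^sub>R v \<in> S \<inter> sphere 0 1"
      using subspace_scale[OF sub that] by simp
    with True show False by blast
  qed
  then show ?thesis
    using that[of 0] linear_0[OF lin] by auto
next
  case False
  have "compact (S \<inter> sphere 0 1)"
    using closed_subspace[OF sub] by (simp add: closed_Int_compact)
  moreover have "continuous_on (S \<inter> sphere 0 1) (\<lambda>v. norm (T v))"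
    by (intro continuous_on_norm linear_continuous_on linear_conv_bounded_linear[THEN iffD1] lin)
  ultimately obtain u where u: "u \<in> S \<inter> sphere 0 1"
    and max: "\<And>v. v \<in> S \<inter> sphere 0 1 \<Longrightarrow> norm (T v) \<le> norm (T u)"
    using continuous_attains_sup[OF _ False] by blast
  have "norm (T v) \<le> norm (T u) * norm v" if v: "v \<in> S" for v
  proof (cases "v = 0")
    case True
    then show ?thesis using linear_0[OF lin] by simp
  next
    case False
    then have "(1 / norm v) *\<^sub>R v \<in> S \<inter> sphere 0 1"
      using subspace_scale[OF sub v] by simp
    from max[OF this] False show ?thesis
      by (simp add: linear_scale[OF lin] field_simps)
  qed
  moreover have "norm (T u) < 1"
    using strict[of u] u by force
  ultimately show ?thesis
    using that[of "norm (T u)"] by auto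
qed

section \<open>Perturbed geometric decay\<close>

text \<open>
  The bound \<open>a k \<le> M * b k\<close> propagates once \<open>\<rho> * M + c \<le> M * \<sigma>\<close>, since then
  \<open>a (Suc k) \<le> M * \<sigma> * b k \<le> M * b (Suc k)\<close>. The hypothesis on \<open>\<sigma> > \<rho>\<close> thus says that the
  perturbation decays more slowly than the recursion forgets.
\<close>

lemma bigo_of_contracting_recursion:
  fixes a b :: "nat \<Rightarrow> real"
  assumes rec: "\<And>k. a (Suc k) \<le> \<rho> * a k + c * b k"
    and a: "\<And>k. 0 \<le> a k" and b: "\<And>k. 0 < b k"
    and \<rho>: "0 \<le> \<rho>" "\<rho> < \<sigma>"
    and slow: "\<forall>\<^sub>F k in sequentially. \<sigma> * b k \<le> b (Suc k)"
  shows "a \<in> O(b)"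
proof -
  obtain N where N: "\<And>k. k \<ge> N \<Longrightarrow> \<sigma> * b k \<le> b (Suc k)"
    using slow by (auto simp: eventually_sequentially)
  \<comment> \<open>The first term starts the induction at \<open>N\<close>, the second makes it step.\<close>
  define M where "M = max (a N / b N) (c / (\<sigma> - \<rho>))"
  have le_M: "a N / b N \<le> M" "c / (\<sigma> - \<rho>) \<le> M"
    by (simp_all add: M_def)
  have "0 \<le> a N / b N"
    using a[of N] b[of N] by simp
  then have M: "0 \<le> M" "a N \<le> M * b N" "c \<le> M * (\<sigma> - \<rho>)"
    using le_M b[of N] \<rho> by (linarith, simp_all add: pos_divide_le_eq)
  have bound: "a k \<le> M * b k" if "k \<ge> N" for k
    using that
  proof (induction k rule: dec_induct)
    case base
    show ?case by (rule M)
  next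
    case (step k)
    have "a (Suc k) \<le> \<rho> * (M * b k) + M * (\<sigma> - \<rho>) * b k"
      using rec[of k] mult_left_mono[OF step.IH \<rho>(1)] mult_right_mono[OF M(3), of "b k"] b[of k]
      by linarith
    also have "\<dots> = M * (\<sigma> * b k)" by (simp add: algebra_simps)
    also have "\<dots> \<le> M * b (Suc k)"
      using N[OF step.hyps(1)] M(1) by (rule mult_left_mono)
    finally show ?case .
  qed
  show ?thesis
    using a b bound
    by (intro bigoI[where c = M] eventually_sequentiallyI[of N]) (simp add: less_imp_le)
qed

section \<open>Row averages and columns of matrices\<close>

lemma row_average_nth:
  fixes x :: "real ^ 'p ^ 'n::finite"
  shows "row_average x $ i $ j = (\<Sum>k\<in>UNIV. x $ k $ j) / real CARD('n)"
  by (simp add: row_average_def columnvector_def rowvector_def ones_def matrix_matrix_mult_def)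

lemma ones_inner: "ones \<bullet> v = (\<Sum>i\<in>UNIV. v $ i)" for v :: "real ^ 'n::finite"
  by (simp add: ones_def inner_vec_def)

lemma column_matrix_mult: "column j (A ** X) = A *v column j X"
  for A :: "real ^ 'm ^ 'n" and X :: "real ^ 'p ^ 'm"
  by (simp add: column_def matrix_matrix_mult_def matrix_vector_mult_def vec_eq_iff)

lemma norm_matrix_columns:
  fixes X :: "real ^ 'p::finite ^ 'n::finite"
  shows "(norm X)\<^sup>2 = (\<Sum>j\<in>UNIV. (norm (column j X))\<^sup>2)"
  unfolding power2_norm_eq_inner inner_vec_def column_def
  by (simp, rule sum.swap)

text \<open>
  Left multiplication acts on each column separately and the squared Frobenius norm is the sum of the
  squared norms of the columns, so a contraction estimate for vectors passes to matrices.
\<close>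

lemma norm_matrix_mult_le_columnwise:
  fixes A :: "real ^ 'm::finite ^ 'n::finite" and X :: "real ^ 'p::finite ^ 'm"
  assumes "0 \<le> \<rho>" and "\<And>j. norm (A *v column j X) \<le> \<rho> * norm (column j X)"
  shows "norm (A ** X) \<le> \<rho> * norm X"
proof (rule power2_le_imp_le)
  have "(norm (A ** X))\<^sup>2 \<le> (\<Sum>j\<in>UNIV. (\<rho> * norm (column j X))\<^sup>2)"
    unfolding norm_matrix_columns column_matrix_mult
    by (intro sum_mono power_mono assms) simp
  also have "\<dots> = (\<rho> * norm X)\<^sup>2"
    by (simp add: power_mult_distrib norm_matrix_columns sum_distrib_left)
  finally show "(norm (A ** X))\<^sup>2 \<le> (\<rho> * norm X)\<^sup>2" .
qed (use assms in simp)

lemma linear_deviation: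
  "linear (\<lambda>X :: real ^ 'p::finite ^ 'n::finite. X - row_average X)"
  by (rule linearI)
    (simp_all add: vec_eq_iff row_average_nth sum.distrib add_divide_distrib
      right_diff_distrib flip: sum_distrib_left)

lemma column_deviation_orthogonal:
  fixes X :: "real ^ 'p::finite ^ 'n::finite"
  shows "ones \<bullet> column j (X - row_average X) = 0"
  by (simp add: ones_inner column_def row_average_nth sum_subtractf)

section \<open>Mixing matrices\<close>

lemma mixing_matrix_ones:
  assumes "mixing_matrix E W"
  shows "W *v ones = ones"
proof -
  have "ones \<in> {v. (mat 1 - W) *v v = 0}"
    using assms span_base[of ones "{ones}"] unfolding mixing_matrix_def by blast
  then show ?thesis
    by (simp add: matrix_vector_mult_diff_rdistrib)
qed

lemma mixing_matrix_self_adjoint: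
  fixes W :: "real ^ 'n::finite ^ 'n"
  assumes "mixing_matrix E W"
  shows "(W *v u) \<bullet> v = u \<bullet> (W *v v)"
proof -
  have "transpose W = W"
    using assms unfolding mixing_matrix_def by metis
  then show ?thesis
    using dot_lmul_matrix[of u W v] by (metis transpose_matrix_vector)
qed

text \<open>
  The null space condition makes every fixed vector of \<open>W\<close> a multiple of the all-ones vector, so
  the hyperplane orthogonal to it contains no nonzero fixed vector.
\<close>

lemma mixing_matrix_contraction:
  fixes W :: "real ^ 'n::finite ^ 'n"
  assumes W: "mixing_matrix E W"
  obtains \<rho> where "0 \<le> \<rho>" "\<rho> < 1" "\<And>v. ones \<bullet> v = 0 \<Longrightarrow> norm (W *v v) \<le> \<rho> * norm v"
proof -
  have fixed: "{v. (mat 1 - W) *v v = 0} = span {ones}"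
    using W unfolding mixing_matrix_def by blast
  have psd: "pos_semidef (mat 1 - W)" and pd: "pos_def (W - (- mat 1))"
    using W unfolding mixing_matrix_def by blast+
  have "norm (W *v v) < norm v" if v: "v \<in> {v. ones \<bullet> v = 0}" "v \<noteq> 0" for v
  proof (rule norm_less_of_spectrum_in_half_open_interval)
    show "linear ((*v) W)" by (rule matrix_vector_mul_linear)
    show "(W *v u) \<bullet> w = u \<bullet> (W *v w)" for u w
      by (rule mixing_matrix_self_adjoint[OF W])
    show "0 \<le> u \<bullet> (u - W *v u)" for u
      using psd by (simp add: pos_semidef_def matrix_vector_mult_diff_rdistrib)
    show "0 < u \<bullet> (u + W *v u)" if "u \<noteq> 0" for u
      using pd that
      by (simp add: pos_def_def matrix_vector_mult_add_rdistrib add.commute)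
    show "W *v v \<noteq> v"
    proof
      assume "W *v v = v"
      then have "v \<in> span {ones}"
        unfolding fixed[symmetric] by (simp add: matrix_vector_mult_diff_rdistrib)
      then obtain c where "v = c *\<^sub>R ones"
        by (auto simp: span_singleton)
      with v show False by auto
    qed
  qed
  from uniform_contraction_on_subspace[OF matrix_vector_mul_linear subspace_hyperplane this]
  show ?thesis
    using that by auto
qed

text \<open>
  \<open>W\<close> commutes with averaging, and in fact each composition is again the row average: the row
  sums of \<open>W\<close> are \<open>1\<close>, so averaged rows are left unchanged, and by symmetry so are the column
  sums, so mixing preserves the average.
\<close>

lemma mixing_matrix_deviation:
  fixes W :: "real ^ 'n::finite ^ 'n" and X :: "real ^ 'p::finite ^ 'n"
  assumes W: "mixing_matrix E W"
  shows "W ** X - row_average (W ** X) = W ** (X - row_average X)"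
proof -
  have "row_average (W ** X) = row_average X"
  proof -
    have "ones \<bullet> column j (W ** X) = ones \<bullet> column j X" for j
      by (metis column_matrix_mult mixing_matrix_self_adjoint[OF W] mixing_matrix_ones[OF W])
    then show ?thesis
      by (simp add: vec_eq_iff row_average_nth ones_inner column_def)
  qed
  moreover have "W ** row_average X = row_average X"
  proof -
    have "(\<Sum>k\<in>UNIV. W $ i $ k) = 1" for i
      using mixing_matrix_ones[OF W]
      by (simp add: vec_eq_iff matrix_vector_mult_def ones_def)
    moreover have "(W ** row_average X) $ i $ j = (\<Sum>k\<in>UNIV. W $ i $ k) * row_average X $ i $ j" for i j
      unfolding sum_distrib_right by (simp add: row_average_nth matrix_matrix_mult_def)
    ultimately show ?thesis
      by (simp add: vec_eq_iff)
  qed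
  ultimately show ?thesis
    by (simp add: vec_eq_iff matrix_matrix_mult_def right_diff_distrib sum_subtractf)
qed

section \<open>Consensus rate\<close>

theorem proposition3:
  fixes E :: "('n::finite \<times> 'n) set"
    and W :: "real ^ 'n ^ 'n"
    and f :: "'n \<Rightarrow> real ^ 'p::finite \<Rightarrow> real"
    and L :: "'n \<Rightarrow> real"
    and Lf \<epsilon> B :: real
    and \<alpha> :: "nat \<Rightarrow> real"
    and x :: "nat \<Rightarrow> real ^ 'p ^ 'n"
  assumes "connected_undirected_graph E"
    and "mixing_matrix E W"
    and "\<And>i z. f i differentiable (at z)"
    and "\<And>i. L i > 0"
    and "\<And>i. (L i)-lipschitz_on UNIV (gradient (f i))"
    and "Lf = Max (range L)"
    and "0 < \<epsilon>" and "\<epsilon> \<le> 1"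
    and "\<And>k. \<alpha> k = 1 / (Lf * (real k + 1) powr \<epsilon>)"
    and "dgd_sequence W \<alpha> f x"
    and "B > 0"
    and "\<And>k. norm (stacked_gradient f (x k)) \<le> B"
  shows "(\<lambda>k. norm (x k - row_average (x k))) \<longlonglongrightarrow> 0 \<and>
         (\<lambda>k. norm (x k - row_average (x k))) \<in> O(\<lambda>k. 1 / (real k + 1) powr \<epsilon>)"
proof -
  define dev where "dev = (\<lambda>X :: real ^ 'p ^ 'n. X - row_average X)"
  define b where "b = (\<lambda>k. 1 / (real k + 1) powr \<epsilon>)"
  obtain \<rho> where \<rho>: "0 \<le> \<rho>" "\<rho> < 1"
    and contr: "\<And>v. ones \<bullet> v = 0 \<Longrightarrow> norm (W *v v) \<le> \<rho> * norm v"
    using mixing_matrix_contraction[OF assms(2)] by blast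
  have lin: "linear dev"
    unfolding dev_def by (rule linear_deviation)
  \<comment> \<open>The operator norm of the deviation map bounds the deviation of the gradients.\<close>
  obtain K where K: "K > 0" "\<And>X. norm (dev X) \<le> K * norm X"
    using linear_bounded_pos[OF lin] by blast
  have step: "norm (dev (x (Suc k))) \<le> \<rho> * norm (dev (x k)) + (K * B / \<bar>Lf\<bar>) * b k" for k
  proof -
    define g where "g = stacked_gradient f (x k)"
    have "x (Suc k) = W ** x k - \<alpha> k *\<^sub>R g"
      using assms(10) by (simp add: dgd_sequence_def g_def)
    then have "dev (x (Suc k)) = dev (W ** x k) - \<alpha> k *\<^sub>R dev g"
      by (simp add: linear_diff[OF lin] linear_scale[OF lin])
    also have "dev (W ** x k) = W ** dev (x k)"
      unfolding dev_def by (rule mixing_matrix_deviation[OF assms(2)])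
    finally have "norm (dev (x (Suc k))) \<le> norm (W ** dev (x k)) + \<bar>\<alpha> k\<bar> * norm (dev g)"
      using norm_triangle_ineq4[of "W ** dev (x k)" "\<alpha> k *\<^sub>R dev g"] by simp
    moreover have "norm (W ** dev (x k)) \<le> \<rho> * norm (dev (x k))"
      unfolding dev_def
      by (intro norm_matrix_mult_le_columnwise \<rho> contr column_deviation_orthogonal)
    moreover have "norm (dev g) \<le> K * B"
      using K(1) assms(12)[of k] by (intro order_trans[OF K(2)] mult_left_mono) (auto simp: g_def)
    then have "\<bar>\<alpha> k\<bar> * norm (dev g) \<le> \<bar>\<alpha> k\<bar> * (K * B)"
      by (rule mult_left_mono) simp
    moreover have "\<bar>\<alpha> k\<bar> * (K * B) = (K * B / \<bar>Lf\<bar>) * b k"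
      by (simp add: assms(9) b_def abs_mult)
    ultimately show ?thesis by linarith
  qed
  have "(\<lambda>k. b (Suc k) / b k) \<longlonglongrightarrow> 1"
    unfolding b_def by real_asymp
  \<comment> \<open>Any number strictly between \<open>\<rho>\<close> and \<open>1\<close> would do in place of the midpoint.\<close>
  then have "\<forall>\<^sub>F k in sequentially. (\<rho> + 1) / 2 < b (Suc k) / b k"
    using \<rho> by (intro order_tendstoD) auto
  then have slow: "\<forall>\<^sub>F k in sequentially. (\<rho> + 1) / 2 * b k \<le> b (Suc k)"
    by eventually_elim (simp add: b_def field_simps)
  have rate: "(\<lambda>k. norm (dev (x k))) \<in> O(b)"
    by (rule bigo_of_contracting_recursion[OF step _ _ \<rho>(1) _ slow])
      (use \<rho> in \<open>auto simp: b_def\<close>)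
  have "b \<longlonglongrightarrow> 0"
    unfolding b_def using assms(7) by real_asymp
  then have "b \<in> o(\<lambda>_. 1)"
    by (intro smalloI_tendsto) auto
  with rate have "(\<lambda>k. norm (dev (x k))) \<in> o(\<lambda>_. 1)"
    by (rule landau_o.big_small_trans)
  then have "(\<lambda>k. norm (dev (x k))) \<longlonglongrightarrow> 0"
    using smalloD_tendsto by force
  with rate show ?thesis
    by (simp add: dev_def b_def)
qed

end
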